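(* Let $S$ be an inverse semigroup and let $\nu$ be a congruence on $S$. Then $G_u(\ker\nu)_{F_\nu}$ is an open normal subgroupoid of $G_u(S)_{F_\nu}$.
   Context: An inverse semigroup is a semigroup $S$ in which every $s$ has a unique $s^*$ with $s=ss^*s$, $s^*=s^*ss^*$. $E(S)$ is the (commutative) semigroup of idempotents. A subsemigroup is a subset closed under product and $s\mapsto s^*$. A congruence $\nu$ on $S$ is an equivalence relation such that $(s,t)\in\nu$ implies $(as,at),(sa,ta)\in\nu$ for all $a\in S$; then $S/\nu$ is an inverse semigroup; let $q\colon S\to S/\nu$ be the quotient map. Put $\ker\nu=q^{-1}(E(S/\nu))$, a subsemigroup of $S$ containing $E(S)$. $\widehat{E(S)}$ is the set of nonzero semigroup homomorphisms $E(S)\to\{0,1\}$ with the topology of pointwise convergence. For $e\in E(S)$ let $D_e=\{\xi\in\widehat{E(S)}:\xi(e)=1\}$; for $s\in S$ and $\xi\in D_{s^*s}$ let $\beta_s(\xi)\in D_{ss^*}$ be $\beta_s(\xi)(e)=\xi(s^*es)$. Universal groupoid $G_u(S)$: the set of classes $[s,\xi]$ of pairs $(s,\xi)\in S\times\widehat{E(S)}$ with $\xi(s^*s)=1$, where $(s,\xi)\sim(t,\eta)$ iff $\xi=\eta$ and there is $e\in E(S)$ with $\xi(e)=1$ and $se=te$. The unit space is $\widehat{E(S)}$ (via $\xi\mapsto[e,\xi]$ for any $e$ with $\xi(e)=1$), $d([s,\xi])=\xi$, $r([s,\xi])=\beta_s(\xi)$, $[s,\beta_t(\xi)][t,\xi]=[st,\xi]$,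 $[s,\xi]^{-1}=[s^*,\beta_s(\xi)]$. The sets $\{[s,\xi]:\xi\in U\}$, with $s\in S$ and $U\subset D_{s^*s}$ open, form a basis of the topology. If $H\subset S$ is a subsemigroup with $E(S)\subset H$, then $[s,\xi]\mapsto[s,\xi]$ identifies $G_u(H)$ with an open subgroupoid of $G_u(S)$. For a groupoid $G$ and an invariant set $F\subset G^{(0)}$ (i.e. $d(\alpha)\in F\Rightarrow r(\alpha)\in F$), $G_F=d^{-1}(F)$ with the relative topology. Here $$F_\nu=\{\xi\circ q|_{E(S)}\in\widehat{E(S)}:\xi\in\widehat{E(S/\nu)}\},$$ a closed invariant subset of $\widehat{E(S)}$. A subgroupoid $H$ of $G$ is normal if $G^{(0)}\subset H\subset\{\gamma\in G:d(\gamma)=r(\gamma)\}$ and $\alpha H\alpha^{-1}\subset H$ for all $\alpha\in G$. *)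

theory Defs
  imports "HOL-Algebra.Congruence" "HOL-Analysis.Function_Topology"
begin

record 'a semigroup_str = "'a partial_object" +
  sprod :: "'a \<Rightarrow> 'a \<Rightarrow> 'a" (infixl \<open>\<cdot>\<index>\<close> 70)

locale inverse_semigroup =
  fixes S :: "('a, 'm) semigroup_str_scheme" (structure)
  assumes sprod_closed: "\<lbrakk>s \<in> carrier S; t \<in> carrier S\<rbrakk> \<Longrightarrow> s \<cdot> t \<in> carrier S"
    and sprod_assoc: "\<lbrakk>s \<in> carrier S; t \<in> carrier S; u \<in> carrier S\<rbrakk> \<Longrightarrow> s \<cdot> t \<cdot> u = s \<cdot> (t \<cdot> u)"
    and ex1_star: "s \<in> carrier S \<Longrightarrow> \<exists>!t. t \<in> carrier S \<and> s = s \<cdot> t \<cdot> s \<and> t = t \<cdot> s \<cdot> t"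

definition star :: "('a, 'm) semigroup_str_scheme \<Rightarrow> 'a \<Rightarrow> 'a" where
  "star S s = (THE t. t \<in> carrier S \<and> s = s \<cdot>\<^bsub>S\<^esub> t \<cdot>\<^bsub>S\<^esub> s \<and> t = t \<cdot>\<^bsub>S\<^esub> s \<cdot>\<^bsub>S\<^esub> t)"

definition idems :: "('a, 'm) semigroup_str_scheme \<Rightarrow> 'a set" where
  "idems S = {e \<in> carrier S. e \<cdot>\<^bsub>S\<^esub> e = e}"

definition congruence :: "('a, 'm) semigroup_str_scheme \<Rightarrow> ('a \<times> 'a) set \<Rightarrow> bool" where
  "congruence S \<nu> \<longleftrightarrow> equiv (carrier S) \<nu> \<and>
     (\<forall>(s, t) \<in> \<nu>. \<forall>a \<in> carrier S. (a \<cdot>\<^bsub>S\<^esub> s, a \<cdot>\<^bsub>S\<^esub> t) \<in> \<nu> \<and> (s \<cdot>\<^bsub>S\<^esub> a, t \<cdot>\<^bsub>S\<^esub> a) \<in> \<nu>)"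

definition quot_map :: "('a \<times> 'a) set \<Rightarrow> 'a \<Rightarrow> 'a set" where
  "quot_map \<nu> s = \<nu> `` {s}"

text \<open>For a congruence, the saturation of the elementwise product of the classes of
  \<open>s\<close> and \<open>t\<close> is the class of \<open>s \<cdot> t\<close>.\<close>

definition quot_semigroup :: "('a, 'm) semigroup_str_scheme \<Rightarrow> ('a \<times> 'a) set \<Rightarrow> 'a set semigroup_str" where
  "quot_semigroup S \<nu> =
     \<lparr>carrier = carrier S // \<nu>, sprod = (\<lambda>A B. \<nu> `` {s \<cdot>\<^bsub>S\<^esub> t |s t. s \<in> A \<and> t \<in> B})\<rparr>"

definition cong_ker :: "('a, 'm) semigroup_str_scheme \<Rightarrow> ('a \<times> 'a) set \<Rightarrow> ('a, 'm) semigroup_str_scheme" where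
  "cong_ker S \<nu> = S\<lparr>carrier := {s \<in> carrier S. quot_map \<nu> s \<in> idems (quot_semigroup S \<nu>)}\<rparr>"

text \<open>Characters are extensional functions, i.e. \<open>undefined\<close> off \<open>idems S\<close>, so that the same
  function is a character of \<open>S\<close> and of any subsemigroup with the same idempotents.\<close>

definition chars :: "('a, 'm) semigroup_str_scheme \<Rightarrow> ('a \<Rightarrow> nat) set" where
  "chars S = {\<xi> \<in> idems S \<rightarrow>\<^sub>E {0, 1}.
     (\<forall>e \<in> idems S. \<forall>f \<in> idems S. \<xi> (e \<cdot>\<^bsub>S\<^esub> f) = \<xi> e * \<xi> f) \<and> (\<exists>e \<in> idems S. \<xi> e \<noteq> 0)}"

definition char_topology :: "('a, 'm) semigroup_str_scheme \<Rightarrow> ('a \<Rightarrow> nat) topology" where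
  "char_topology S =
     subtopology (product_topology (\<lambda>_. discrete_topology {0, 1}) (idems S)) (chars S)"

definition char_dom :: "('a, 'm) semigroup_str_scheme \<Rightarrow> 'a \<Rightarrow> ('a \<Rightarrow> nat) set" where
  "char_dom S e = {\<xi> \<in> chars S. \<xi> e = 1}"

definition char_act :: "('a, 'm) semigroup_str_scheme \<Rightarrow> 'a \<Rightarrow> ('a \<Rightarrow> nat) \<Rightarrow> 'a \<Rightarrow> nat" where
  "char_act S s \<xi> = (\<lambda>e \<in> idems S. \<xi> (star S s \<cdot>\<^bsub>S\<^esub> e \<cdot>\<^bsub>S\<^esub> s))"

definition cong_chars :: "('a, 'm) semigroup_str_scheme \<Rightarrow> ('a \<times> 'a) set \<Rightarrow> ('a \<Rightarrow> nat) set" where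
  "cong_chars S \<nu> =
     {\<eta> \<in> chars S. \<exists>\<xi> \<in> chars (quot_semigroup S \<nu>). \<eta> = restrict (\<xi> \<circ> quot_map \<nu>) (idems S)}"

text \<open>The unit space is kept as a separate set \<open>obj\<close>, identified with a set of arrows
  through \<open>unit\<close>; \<open>arr_top\<close> is the topology on arrows.\<close>

record ('g, 'o) groupoid_str =
  arr :: "'g set"
  obj :: "'o set"
  unit :: "'o \<Rightarrow> 'g"
  gdom :: "'g \<Rightarrow> 'o"
  grng :: "'g \<Rightarrow> 'o"
  gcomp :: "'g \<Rightarrow> 'g \<Rightarrow> 'g" (infixl \<open>\<odot>\<index>\<close> 70)
  ginv :: "'g \<Rightarrow> 'g"
  arr_top :: "'g topology"

locale groupoid =
  fixes G :: "('g, 'o, 'm) groupoid_str_scheme" (structure)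
  assumes dom_obj: "\<alpha> \<in> arr G \<Longrightarrow> gdom G \<alpha> \<in> obj G"
    and rng_obj: "\<alpha> \<in> arr G \<Longrightarrow> grng G \<alpha> \<in> obj G"
    and unit_arr: "x \<in> obj G \<Longrightarrow> unit G x \<in> arr G"
    and dom_unit: "x \<in> obj G \<Longrightarrow> gdom G (unit G x) = x"
    and rng_unit: "x \<in> obj G \<Longrightarrow> grng G (unit G x) = x"
    and comp_arr: "\<lbrakk>\<alpha> \<in> arr G; \<beta> \<in> arr G; gdom G \<alpha> = grng G \<beta>\<rbrakk> \<Longrightarrow> \<alpha> \<odot> \<beta> \<in> arr G"
    and dom_comp: "\<lbrakk>\<alpha> \<in> arr G; \<beta> \<in> arr G; gdom G \<alpha> = grng G \<beta>\<rbrakk> \<Longrightarrow> gdom G (\<alpha> \<odot> \<beta>) = gdom G \<beta>"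
    and rng_comp: "\<lbrakk>\<alpha> \<in> arr G; \<beta> \<in> arr G; gdom G \<alpha> = grng G \<beta>\<rbrakk> \<Longrightarrow> grng G (\<alpha> \<odot> \<beta>) = grng G \<alpha>"
    and comp_assoc: "\<lbrakk>\<alpha> \<in> arr G; \<beta> \<in> arr G; \<gamma> \<in> arr G; gdom G \<alpha> = grng G \<beta>; gdom G \<beta> = grng G \<gamma>\<rbrakk>
      \<Longrightarrow> \<alpha> \<odot> \<beta> \<odot> \<gamma> = \<alpha> \<odot> (\<beta> \<odot> \<gamma>)"
    and comp_unit_right: "\<alpha> \<in> arr G \<Longrightarrow> \<alpha> \<odot> unit G (gdom G \<alpha>) = \<alpha>"
    and comp_unit_left: "\<alpha> \<in> arr G \<Longrightarrow> unit G (grng G \<alpha>) \<odot> \<alpha> = \<alpha>"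
    and inv_arr: "\<alpha> \<in> arr G \<Longrightarrow> ginv G \<alpha> \<in> arr G"
    and dom_inv: "\<alpha> \<in> arr G \<Longrightarrow> gdom G (ginv G \<alpha>) = grng G \<alpha>"
    and rng_inv: "\<alpha> \<in> arr G \<Longrightarrow> grng G (ginv G \<alpha>) = gdom G \<alpha>"
    and inv_comp: "\<alpha> \<in> arr G \<Longrightarrow> ginv G \<alpha> \<odot> \<alpha> = unit G (gdom G \<alpha>)"
    and comp_inv: "\<alpha> \<in> arr G \<Longrightarrow> \<alpha> \<odot> ginv G \<alpha> = unit G (grng G \<alpha>)"

locale subgroupoid = groupoid G for H :: "'g set" and G :: "('g, 'o, 'm) groupoid_str_scheme" (structure) +
  assumes sub_arr: "H \<subseteq> arr G"
    and sub_comp: "\<lbrakk>\<alpha> \<in> H; \<beta> \<in> H; gdom G \<alpha> = grng G \<beta>\<rbrakk> \<Longrightarrow> \<alpha> \<odot> \<beta> \<in> H"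
    and sub_inv: "\<alpha> \<in> H \<Longrightarrow> ginv G \<alpha> \<in> H"

locale normal_subgroupoid = subgroupoid +
  assumes units_sub: "unit G ` obj G \<subseteq> H"
    and isotropy: "H \<subseteq> {\<gamma> \<in> arr G. gdom G \<gamma> = grng G \<gamma>}"
    and conj_sub: "\<lbrakk>\<alpha> \<in> arr G; \<gamma> \<in> H; gdom G \<alpha> = grng G \<gamma>\<rbrakk> \<Longrightarrow> \<alpha> \<odot> \<gamma> \<odot> ginv G \<alpha> \<in> H"

definition reduction :: "('g, 'o, 'm) groupoid_str_scheme \<Rightarrow> 'o set \<Rightarrow> ('g, 'o, 'm) groupoid_str_scheme" where
  "reduction G F = G\<lparr>arr := {\<alpha> \<in> arr G. gdom G \<alpha> \<in> F}, obj := obj G \<inter> F,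
     arr_top := subtopology (arr_top G) {\<alpha> \<in> arr G. gdom G \<alpha> \<in> F}\<rparr>"

type_synonym 'a germ = "('a \<times> ('a \<Rightarrow> nat)) set"

definition germ_rel :: "('a, 'm) semigroup_str_scheme \<Rightarrow> (('a \<times> ('a \<Rightarrow> nat)) \<times> ('a \<times> ('a \<Rightarrow> nat))) set" where
  "germ_rel S = {((s, \<xi>), (t, \<eta>)). s \<in> carrier S \<and> t \<in> carrier S \<and>
     \<xi> \<in> char_dom S (star S s \<cdot>\<^bsub>S\<^esub> s) \<and> \<eta> \<in> char_dom S (star S t \<cdot>\<^bsub>S\<^esub> t) \<and>
     \<xi> = \<eta> \<and> (\<exists>e \<in> idems S. \<xi> e = 1 \<and> s \<cdot>\<^bsub>S\<^esub> e = t \<cdot>\<^bsub>S\<^esub> e)}"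

definition germ_of :: "('a, 'm) semigroup_str_scheme \<Rightarrow> 'a \<Rightarrow> ('a \<Rightarrow> nat) \<Rightarrow> 'a germ" where
  "germ_of S s \<xi> = germ_rel S `` {(s, \<xi>)}"

text \<open>The descriptions by \<open>THE\<close> below state the formulas
  \<open>d[s,\<xi>] = \<xi>\<close>, \<open>r[s,\<xi>] = \<beta>\<^sub>s(\<xi>)\<close>, \<open>[s,\<beta>\<^sub>t(\<xi>)][t,\<xi>] = [st,\<xi>]\<close> and \<open>[s,\<xi>]\<^sup>-\<^sup>1 = [s\<^sup>*,\<beta>\<^sub>s(\<xi>)]\<close> on
  representatives. The generating sets of the topology form a base.\<close>

definition universal_groupoid ::
    "('a, 'm) semigroup_str_scheme \<Rightarrow> ('a germ, 'a \<Rightarrow> nat) groupoid_str" where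
  "universal_groupoid S = \<lparr>
     arr = {germ_of S s \<xi> |s \<xi>. s \<in> carrier S \<and> \<xi> \<in> char_dom S (star S s \<cdot>\<^bsub>S\<^esub> s)},
     obj = chars S,
     unit = (\<lambda>\<xi>. THE g. \<exists>e \<in> idems S. \<xi> e = 1 \<and> g = germ_of S e \<xi>),
     gdom = (\<lambda>g. THE \<eta>. \<exists>s \<xi>. s \<in> carrier S \<and> \<xi> \<in> char_dom S (star S s \<cdot>\<^bsub>S\<^esub> s) \<and>
       g = germ_of S s \<xi> \<and> \<eta> = \<xi>),
     grng = (\<lambda>g. THE \<eta>. \<exists>s \<xi>. s \<in> carrier S \<and> \<xi> \<in> char_dom S (star S s \<cdot>\<^bsub>S\<^esub> s) \<and>
       g = germ_of S s \<xi> \<and> \<eta> = char_act S s \<xi>),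
     gcomp = (\<lambda>g h. THE k. \<exists>s t \<xi>. s \<in> carrier S \<and> t \<in> carrier S \<and>
       \<xi> \<in> char_dom S (star S t \<cdot>\<^bsub>S\<^esub> t) \<and> char_act S t \<xi> \<in> char_dom S (star S s \<cdot>\<^bsub>S\<^esub> s) \<and>
       g = germ_of S s (char_act S t \<xi>) \<and> h = germ_of S t \<xi> \<and> k = germ_of S (s \<cdot>\<^bsub>S\<^esub> t) \<xi>),
     ginv = (\<lambda>g. THE h. \<exists>s \<xi>. s \<in> carrier S \<and> \<xi> \<in> char_dom S (star S s \<cdot>\<^bsub>S\<^esub> s) \<and>
       g = germ_of S s \<xi> \<and> h = germ_of S (star S s) (char_act S s \<xi>)),
     arr_top = topology_generated_by {germ_of S s ` U |s U. s \<in> carrier S \<and>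
       openin (char_topology S) U \<and> U \<subseteq> char_dom S (star S s \<cdot>\<^bsub>S\<^esub> s)}\<rparr>"

text \<open>For a subsemigroup \<open>H\<close> of \<open>S\<close> containing \<open>idems S\<close>, this is the canonical map
  \<open>[s,\<xi>] \<mapsto> [s,\<xi>]\<close> from the universal groupoid of \<open>H\<close> to that of \<open>S\<close>: it enlarges a class
  for the germ relation of \<open>H\<close> to a class for that of \<open>S\<close>.\<close>

definition germ_incl :: "('a, 'm) semigroup_str_scheme \<Rightarrow> 'a germ \<Rightarrow> 'a germ" where
  "germ_incl S g = germ_rel S `` g"

end

theory Submission
  imports Defs
begin

text \<open>
  Two observations carry the proof. First, \<open>F\<^sub>\<nu>\<close> consists of the characters that are constant on
  \<open>\<nu>\<close>-related idempotents, because every idempotent of \<open>S/\<nu>\<close> lifts to an idempotent of \<open>S\<close>.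
  Second, \<open>s\<close> lies in \<open>ker \<nu>\<close> iff it is \<open>\<nu>\<close>-related to an idempotent, and then so is \<open>s\<^sup>*\<close>.
  Hence for \<open>s \<in> ker \<nu>\<close> and \<open>e \<in> E(S)\<close> the elements \<open>s\<^sup>*es\<close> and \<open>es\<^sup>*s\<close> are \<open>\<nu>\<close>-related,
  which makes \<open>[s,\<xi>]\<close> isotropic for \<open>\<xi> \<in> F\<^sub>\<nu>\<close>, and \<open>ker \<nu>\<close> is stable under \<open>t \<mapsto> sts\<^sup>*\<close>, which
  gives normality.
\<close>

section \<open>Inverse semigroups\<close>

context inverse_semigroup
begin

declare sprod_closed [simp, intro]

lemma star_exI: "s \<in> carrier S \<Longrightarrow>
    star S s \<in> carrier S \<and> s = s \<cdot> star S s \<cdot> s \<and> star S s = star S s \<cdot> s \<cdot> star S s"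
  unfolding star_def by (rule theI') (rule ex1_star)

lemma star_closed [simp, intro]: "s \<in> carrier S \<Longrightarrow> star S s \<in> carrier S"
  using star_exI by blast

lemma star_unique:
  assumes "s \<in> carrier S" "t \<in> carrier S" "s \<cdot> t \<cdot> s = s" "t \<cdot> s \<cdot> t = t"
  shows "star S s = t"
  using ex1_star[OF assms(1)] star_exI[OF assms(1)] assms by metis

lemma sprod_star_sprod [simp]: "s \<in> carrier S \<Longrightarrow> s \<cdot> (star S s \<cdot> s) = s"
  using star_exI by (metis sprod_assoc)

lemma star_sprod_star [simp]: "s \<in> carrier S \<Longrightarrow> star S s \<cdot> (s \<cdot> star S s) = star S s"
  using star_exI by (metis sprod_assoc)

lemma sprod_star_sprod_left [simp]:
  "\<lbrakk>s \<in> carrier S; t \<in> carrier S\<rbrakk> \<Longrightarrow> s \<cdot> (star S s \<cdot> (s \<cdot> t)) = s \<cdot> t"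
  by (metis sprod_star_sprod sprod_assoc star_closed sprod_closed)

lemma star_sprod_star_left [simp]:
  "\<lbrakk>s \<in> carrier S; t \<in> carrier S\<rbrakk> \<Longrightarrow> star S s \<cdot> (s \<cdot> (star S s \<cdot> t)) = star S s \<cdot> t"
  by (metis star_sprod_star sprod_assoc star_closed sprod_closed)

lemma star_star [simp]: "s \<in> carrier S \<Longrightarrow> star S (star S s) = s"
  by (rule star_unique) (auto simp: sprod_assoc)

lemma idems_carrier [simp]: "e \<in> idems S \<Longrightarrow> e \<in> carrier S"
  by (simp add: idems_def)

lemma idems_idem [simp]: "e \<in> idems S \<Longrightarrow> e \<cdot> e = e"
  unfolding idems_def by simp

lemma idemsI: "\<lbrakk>e \<in> carrier S; e \<cdot> e = e\<rbrakk> \<Longrightarrow> e \<in> idems S"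
  unfolding idems_def by simp

lemma idems_idem_left [simp]:
  "\<lbrakk>e \<in> idems S; t \<in> carrier S\<rbrakk> \<Longrightarrow> e \<cdot> (e \<cdot> t) = e \<cdot> t"
  by (metis sprod_assoc idems_carrier idems_idem)

lemma star_idem [simp]: "e \<in> idems S \<Longrightarrow> star S e = e"
  by (rule star_unique) auto

text \<open>With \<open>x\<close> the inverse of \<open>ef\<close>, \<open>fxe\<close> is an inverse
  of \<open>ef\<close> as well, so uniqueness forces \<open>x = fxe\<close>, and then
  \<open>xx = x\<close>. An idempotent is its own inverse, so \<open>ef\<close>, being the inverse
  of \<open>x\<close>, equals \<open>x\<close>.\<close>

lemma sprod_idems [simp, intro]:
  assumes e: "e \<in> idems S" and f: "f \<in> idems S"
  shows "e \<cdot> f \<in> idems S"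
proof -
  define x where "x = star S (e \<cdot> f)"
  have x: "x \<in> carrier S"
    using e f by (simp add: x_def)
  have efx: "e \<cdot> (f \<cdot> (x \<cdot> (e \<cdot> f))) = e \<cdot> f"
    using e f x sprod_star_sprod[of "e \<cdot> f", folded x_def] by (simp add: sprod_assoc)
  have xef: "x \<cdot> (e \<cdot> (f \<cdot> x)) = x"
    using e f x star_sprod_star[of "e \<cdot> f", folded x_def] by (simp add: sprod_assoc)
  have xefl: "x \<cdot> (e \<cdot> (f \<cdot> (x \<cdot> t))) = x \<cdot> t" if "t \<in> carrier S" for t
  proof -
    have "x \<cdot> (e \<cdot> (f \<cdot> (x \<cdot> t))) = (x \<cdot> (e \<cdot> (f \<cdot> x))) \<cdot> t"
      using e f x that by (simp add: sprod_assoc)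
    then show ?thesis by (simp add: xef)
  qed
  have fxe: "f \<cdot> (x \<cdot> e) = x"
    using star_unique[of "e \<cdot> f" "f \<cdot> (x \<cdot> e)"] e f x efx xefl
    by (simp add: sprod_assoc x_def)
  have "x \<cdot> x = (f \<cdot> (x \<cdot> e)) \<cdot> (f \<cdot> (x \<cdot> e))"
    by (simp add: fxe)
  also have "\<dots> = f \<cdot> (x \<cdot> (e \<cdot> (f \<cdot> (x \<cdot> e))))"
    using e f x by (simp add: sprod_assoc)
  also have "\<dots> = f \<cdot> (x \<cdot> e)"
    using e by (simp only: xefl idems_carrier)
  also note fxe
  finally have "x \<in> idems S"
    using x by (intro idemsI)
  then show ?thesis
    using star_idem[of x] star_star[of "e \<cdot> f"] e f by (simp add: x_def)
qed

text \<open>\<open>fe\<close> is an inverse of the idempotent \<open>ef\<close>, which is also its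
  own inverse; uniqueness identifies the two.\<close>

lemma idems_commute:
  assumes e: "e \<in> idems S" and f: "f \<in> idems S"
  shows "e \<cdot> f = f \<cdot> e"
proof -
  have ef: "e \<cdot> (f \<cdot> (e \<cdot> f)) = e \<cdot> f" and fe: "f \<cdot> (e \<cdot> (f \<cdot> e)) = f \<cdot> e"
    using idems_idem[OF sprod_idems[OF e f]] idems_idem[OF sprod_idems[OF f e]] e f
    by (simp_all add: sprod_assoc del: idems_idem)
  have "star S (e \<cdot> f) = f \<cdot> e"
    by (rule star_unique) (use e f ef fe in \<open>simp_all add: sprod_assoc\<close>)
  then show ?thesis
    using star_idem[OF sprod_idems[OF e f]] by simp
qed

lemma idems_left_commute:
  "\<lbrakk>e \<in> idems S; f \<in> idems S; t \<in> carrier S\<rbrakk> \<Longrightarrow> e \<cdot> (f \<cdot> t) = f \<cdot> (e \<cdot> t)"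
  by (metis idems_commute sprod_assoc idems_carrier)

lemma sprod_star_idem [simp, intro]: "s \<in> carrier S \<Longrightarrow> s \<cdot> star S s \<in> idems S"
  by (rule idemsI) (simp_all add: sprod_assoc)

lemma star_sprod_idem [simp, intro]: "s \<in> carrier S \<Longrightarrow> star S s \<cdot> s \<in> idems S"
  by (rule idemsI) (simp_all add: sprod_assoc)

text \<open>Right-associated forms of the commutation of \<open>e\<close> with \<open>s\<^sup>*s\<close> and \<open>ss\<^sup>*\<close>, for rewriting.\<close>

lemma sprod_idem_star_sprod:
  assumes "s \<in> carrier S" "e \<in> idems S"
  shows "s \<cdot> (e \<cdot> (star S s \<cdot> s)) = s \<cdot> e"
  using assms idems_commute[of e "star S s \<cdot> s"] by (simp add: sprod_assoc)

lemma sprod_idem_star_sprod_left: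
  assumes "s \<in> carrier S" "e \<in> idems S" "t \<in> carrier S"
  shows "s \<cdot> (e \<cdot> (star S s \<cdot> (s \<cdot> t))) = s \<cdot> (e \<cdot> t)"
proof -
  have "s \<cdot> (e \<cdot> (star S s \<cdot> (s \<cdot> t))) = (s \<cdot> (e \<cdot> (star S s \<cdot> s))) \<cdot> t"
    using assms by (simp add: sprod_assoc)
  also have "\<dots> = s \<cdot> (e \<cdot> t)"
    using assms by (simp add: sprod_idem_star_sprod sprod_assoc)
  finally show ?thesis .
qed

lemma conj_idems [simp, intro]:
  assumes "s \<in> carrier S" "e \<in> idems S"
  shows "s \<cdot> e \<cdot> star S s \<in> idems S"
  using assms by (intro idemsI) (simp_all add: sprod_assoc sprod_idem_star_sprod_left)

lemma star_conj_idems [simp, intro]: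
  "\<lbrakk>s \<in> carrier S; e \<in> idems S\<rbrakk> \<Longrightarrow> star S s \<cdot> e \<cdot> s \<in> idems S"
  using conj_idems[of "star S s" e] by simp

text \<open>Lets an idempotent cross \<open>s\<close> from left to right at the price of a
  conjugation; it works because \<open>e\<close> commutes with \<open>ss\<^sup>*\<close>.\<close>

lemma sprod_star_conj:
  assumes "s \<in> carrier S" "e \<in> idems S"
  shows "s \<cdot> (star S s \<cdot> e \<cdot> s) = e \<cdot> s"
  using assms idems_left_commute[of "s \<cdot> star S s" e s] by (simp add: sprod_assoc)

text \<open>In both inverse laws the idempotents \<open>s\<^sup>*s\<close> and
  \<open>tt\<^sup>*\<close> meet in the middle; once swapped, each is absorbed by its
  neighbour.\<close>

lemma star_sprod:
  assumes s: "s \<in> carrier S" and t: "t \<in> carrier S"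
  shows "star S (s \<cdot> t) = star S t \<cdot> star S s"
proof (rule star_unique)
  let ?e = "star S s \<cdot> s" and ?f = "t \<cdot> star S t"
  have E: "?e \<in> idems S" "?f \<in> idems S"
    using s t by auto
  have "s \<cdot> t \<cdot> (star S t \<cdot> star S s) \<cdot> (s \<cdot> t) = s \<cdot> (?f \<cdot> (?e \<cdot> t))"
    using s t by (simp add: sprod_assoc)
  also have "\<dots> = s \<cdot> (?e \<cdot> (?f \<cdot> t))"
    using idems_left_commute[OF E(2) E(1) t] by simp
  also have "\<dots> = s \<cdot> t"
    using s t by (simp add: sprod_assoc)
  finally show "s \<cdot> t \<cdot> (star S t \<cdot> star S s) \<cdot> (s \<cdot> t) = s \<cdot> t" .
  have "star S t \<cdot> star S s \<cdot> (s \<cdot> t) \<cdot> (star S t \<cdot> star S s) = star S t \<cdot> (?e \<cdot> (?f \<cdot> star S s))"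
    using s t by (simp add: sprod_assoc)
  also have "\<dots> = star S t \<cdot> (?f \<cdot> (?e \<cdot> star S s))"
    using idems_left_commute[OF E star_closed[OF s]] by simp
  also have "\<dots> = star S t \<cdot> star S s"
    using s t by (simp add: sprod_assoc)
  finally show "star S t \<cdot> star S s \<cdot> (s \<cdot> t) \<cdot> (star S t \<cdot> star S s) = star S t \<cdot> star S s" .
qed (use s t in auto)

section \<open>Characters and germs\<close>

lemma chars_mult: "\<lbrakk>\<xi> \<in> chars S; e \<in> idems S; f \<in> idems S\<rbrakk> \<Longrightarrow> \<xi> (e \<cdot> f) = \<xi> e * \<xi> f"
  by (simp add: chars_def)

lemma char_dom_chars: "\<xi> \<in> char_dom S e \<Longrightarrow> \<xi> \<in> chars S"
  by (simp add: char_dom_def)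

lemma chars_01: "\<lbrakk>\<xi> \<in> chars S; e \<in> idems S\<rbrakk> \<Longrightarrow> \<xi> e = 0 \<or> \<xi> e = 1"
  by (auto simp: chars_def PiE_def Pi_def)

lemma chars_ex_one: "\<xi> \<in> chars S \<Longrightarrow> \<exists>e\<in>idems S. \<xi> e = 1"
  using chars_01 by (fastforce simp: chars_def)

lemma chars_eqI:
  assumes "\<xi> \<in> chars S" "\<eta> \<in> chars S" "\<And>e. e \<in> idems S \<Longrightarrow> \<xi> e = \<eta> e"
  shows "\<xi> = \<eta>"
  by (rule PiE_ext[of _ "idems S" "\<lambda>_. {0,1}"]) (use assms in \<open>auto simp: chars_def\<close>)

lemma char_act_apply [simp]: "e \<in> idems S \<Longrightarrow> char_act S s \<xi> e = \<xi> (star S s \<cdot> e \<cdot> s)"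
  by (simp add: char_act_def)

text \<open>Multiplicativity comes from absorbing the \<open>ss\<^sup>*\<close> that appears between
  \<open>e\<close> and \<open>f\<close>. The action is nonzero because its value at
  \<open>ss\<^sup>*\<close> is that of \<open>\<xi>\<close> at \<open>s\<^sup>*s\<close>.\<close>

lemma char_act_chars:
  assumes s: "s \<in> carrier S" and x: "\<xi> \<in> char_dom S (star S s \<cdot> s)"
  shows "char_act S s \<xi> \<in> char_dom S (s \<cdot> star S s)"
proof -
  have one: "char_act S s \<xi> (s \<cdot> star S s) = 1"
    using s x by (simp add: char_dom_def sprod_assoc)
  have m: "char_act S s \<xi> (e \<cdot> f) = char_act S s \<xi> e * char_act S s \<xi> f"
    if e: "e \<in> idems S" and f: "f \<in> idems S" for e f
  proof -
    have "star S s \<cdot> e \<cdot> s \<cdot> (star S s \<cdot> f \<cdot> s) = star S s \<cdot> e \<cdot> (s \<cdot> (star S s \<cdot> f \<cdot> s))"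
      using s e f by (simp add: sprod_assoc)
    also have "\<dots> = star S s \<cdot> (e \<cdot> f) \<cdot> s"
      using s e f by (simp add: sprod_star_conj) (simp add: sprod_assoc)
    finally show ?thesis
      using s e f x chars_mult[of \<xi> "star S s \<cdot> e \<cdot> s" "star S s \<cdot> f \<cdot> s"]
      by (simp add: char_dom_chars)
  qed
  have "char_act S s \<xi> \<in> idems S \<rightarrow>\<^sub>E {0, 1}"
    using s chars_01[OF char_dom_chars[OF x]] by (auto simp: char_act_def)
  moreover have "\<exists>e\<in>idems S. char_act S s \<xi> e \<noteq> 0"
    using one s by (metis sprod_star_idem zero_neq_one)
  ultimately show ?thesis
    using m one by (simp add: char_dom_def chars_def)
qed

section \<open>Representatives of germs\<close>

definition germ_pair :: "'a \<Rightarrow> ('a \<Rightarrow> nat) \<Rightarrow> bool" where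
  "germ_pair s \<xi> \<longleftrightarrow> s \<in> carrier S \<and> \<xi> \<in> char_dom S (star S s \<cdot> s)"

lemma germ_pairD:
  assumes "germ_pair s \<xi>"
  shows "s \<in> carrier S" "\<xi> \<in> chars S" "\<xi> (star S s \<cdot> s) = 1" "\<xi> \<in> char_dom S (star S s \<cdot> s)"
  using assms by (auto simp: germ_pair_def char_dom_def)

lemma germ_pairI: "\<lbrakk>s \<in> carrier S; \<xi> \<in> chars S; \<xi> (star S s \<cdot> s) = 1\<rbrakk> \<Longrightarrow> germ_pair s \<xi>"
  by (auto simp: germ_pair_def char_dom_def)

lemma germ_pair_idem: "\<lbrakk>e \<in> idems S; \<xi> \<in> chars S; \<xi> e = 1\<rbrakk> \<Longrightarrow> germ_pair e \<xi>"
  by (rule germ_pairI) auto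

lemma germ_pair_act:
  assumes "germ_pair s \<xi>"
  shows "char_act S s \<xi> \<in> chars S" "char_act S s \<xi> (s \<cdot> star S s) = 1"
  using char_act_chars[of s \<xi>] germ_pairD[OF assms] by (auto simp: char_dom_def)

lemma germ_pair_star: "germ_pair s \<xi> \<Longrightarrow> germ_pair (star S s) (char_act S s \<xi>)"
  by (rule germ_pairI) (auto simp: germ_pair_act germ_pairD)

lemma char_act_sprod:
  assumes "s \<in> carrier S" "t \<in> carrier S"
  shows "char_act S (s \<cdot> t) \<xi> = char_act S s (char_act S t \<xi>)"
proof
  fix e
  have "star S (s \<cdot> t) \<cdot> e \<cdot> (s \<cdot> t) = star S t \<cdot> (star S s \<cdot> e \<cdot> s) \<cdot> t" if "e \<in> idems S"
    using assms that by (simp add: star_sprod sprod_assoc)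
  \<comment> \<open>Off \<open>idems S\<close> both sides are \<open>undefined\<close>.\<close>
  then show "char_act S (s \<cdot> t) \<xi> e = char_act S s (char_act S t \<xi>) e"
    using assms by (cases "e \<in> idems S") (simp, simp add: char_act_def)
qed

lemma char_act_idem:
  assumes "e \<in> idems S" "\<xi> \<in> chars S" "\<xi> e = 1"
  shows "char_act S e \<xi> = \<xi>"
proof (rule chars_eqI)
  show "char_act S e \<xi> \<in> chars S"
    using germ_pair_act germ_pair_idem assms by blast
  show "char_act S e \<xi> f = \<xi> f" if "f \<in> idems S" for f
    using that assms by (simp add: chars_mult)
qed (fact assms)

lemma germ_pair_sprod:
  assumes "germ_pair t \<xi>" "germ_pair s (char_act S t \<xi>)"
  shows "germ_pair (s \<cdot> t) \<xi>"
  using germ_pairD[OF assms(1)] germ_pairD[OF assms(2)]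
  by (intro germ_pairI) (auto simp: star_sprod sprod_assoc)

lemma char_act_star_act:
  assumes "germ_pair s \<xi>"
  shows "char_act S (star S s) (char_act S s \<xi>) = \<xi>"
  using germ_pairD[OF assms] char_act_sprod[of "star S s" s \<xi>, symmetric]
  by (simp add: char_act_idem)

text \<open>For reflexivity a nonzero character supplies an idempotent of value 1. For transitivity
  the product of the two witnessing idempotents is a witness, since idempotents commute.\<close>

lemma equiv_germ_rel: "equiv {(s, \<xi>). germ_pair s \<xi>} (germ_rel S)"
proof (rule equivI)
  show "germ_rel S \<subseteq> {(s, \<xi>). germ_pair s \<xi>} \<times> {(s, \<xi>). germ_pair s \<xi>}"
    by (auto simp: germ_rel_def germ_pair_def)
  show "refl_on {(s, \<xi>). germ_pair s \<xi>} (germ_rel S)"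
    using chars_ex_one by (fastforce simp: refl_on_def germ_rel_def germ_pair_def char_dom_def)
  show "sym (germ_rel S)"
    unfolding sym_def germ_rel_def by (auto; metis)
  show "trans (germ_rel S)"
  proof (rule transI)
    fix x y z assume "(x, y) \<in> germ_rel S" "(y, z) \<in> germ_rel S"
    then obtain s t u \<xi> e f where *: "x = (s, \<xi>)" "y = (t, \<xi>)" "z = (u, \<xi>)"
        "germ_pair s \<xi>" "germ_pair t \<xi>" "germ_pair u \<xi>"
        "e \<in> idems S" "f \<in> idems S" "\<xi> e = 1" "\<xi> f = 1" "s \<cdot> e = t \<cdot> e" "t \<cdot> f = u \<cdot> f"
      by (fastforce simp: germ_rel_def germ_pair_def)
    have S: "s \<in> carrier S" "t \<in> carrier S" "u \<in> carrier S" "\<xi> \<in> chars S"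
      using * by (auto simp: germ_pairD)
    note E = \<open>e \<in> idems S\<close> \<open>f \<in> idems S\<close>
    have "s \<cdot> (e \<cdot> f) = s \<cdot> e \<cdot> f" using E S by (simp add: sprod_assoc)
    also have "\<dots> = t \<cdot> e \<cdot> f" using * by simp
    also have "\<dots> = t \<cdot> f \<cdot> e" using E S by (simp add: sprod_assoc idems_commute[of e f])
    also have "\<dots> = u \<cdot> f \<cdot> e" using * by simp
    also have "\<dots> = u \<cdot> (e \<cdot> f)" using E S by (simp add: sprod_assoc idems_commute[of e f])
    finally have "s \<cdot> (e \<cdot> f) = u \<cdot> (e \<cdot> f)" .
    moreover have "\<xi> (e \<cdot> f) = 1" using * S by (simp add: chars_mult)
    ultimately show "(x, z) \<in> germ_rel S"
      using * by (auto simp: germ_rel_def germ_pair_def)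
  qed
qed

lemma germ_of_eq_iff:
  assumes "germ_pair s \<xi>" "germ_pair t \<eta>"
  shows "germ_of S s \<xi> = germ_of S t \<eta> \<longleftrightarrow> \<xi> = \<eta> \<and> (\<exists>e\<in>idems S. \<xi> e = 1 \<and> s \<cdot> e = t \<cdot> e)"
  unfolding germ_of_def using assms
  by (subst eq_equiv_class_iff[OF equiv_germ_rel]) (auto simp: germ_rel_def germ_pair_def)

lemma germ_of_eqI:
  assumes "germ_pair s \<xi>" "germ_pair t \<xi>" "e \<in> idems S" "\<xi> e = 1" "s \<cdot> e = t \<cdot> e"
  shows "germ_of S s \<xi> = germ_of S t \<xi>"
  using assms by (auto simp: germ_of_eq_iff)

lemma germ_of_eqE:
  assumes "germ_pair s \<xi>" "germ_pair t \<eta>" "germ_of S s \<xi> = germ_of S t \<eta>"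
  obtains e where "\<xi> = \<eta>" "e \<in> idems S" "\<xi> e = 1" "s \<cdot> e = t \<cdot> e"
  using assms by (auto simp: germ_of_eq_iff)

text \<open>As \<open>\<xi> e = 1\<close>, replacing \<open>u\<close> by \<open>ue\<close> does not
  change the value of \<open>\<xi>\<close> at \<open>u\<^sup>*fu\<close>, so this value depends on
  \<open>ue\<close> only. It makes the range well defined on germs.\<close>

lemma char_act_germ_cong:
  assumes s: "germ_pair s \<xi>" and t: "germ_pair t \<xi>" and e: "e \<in> idems S" "\<xi> e = 1" "s \<cdot> e = t \<cdot> e"
  shows "char_act S s \<xi> = char_act S t \<xi>"
proof (rule chars_eqI)
  fix f assume f: "f \<in> idems S"
  have *: "\<xi> (star S u \<cdot> f \<cdot> u) = \<xi> (star S (u \<cdot> e) \<cdot> f \<cdot> (u \<cdot> e))" if "germ_pair u \<xi>" for u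
  proof -
    have u: "u \<in> carrier S" "\<xi> \<in> chars S" using that by (auto simp: germ_pairD)
    have "star S (u \<cdot> e) \<cdot> f \<cdot> (u \<cdot> e) = e \<cdot> (star S u \<cdot> f \<cdot> u) \<cdot> e"
      using u e f by (simp add: star_sprod sprod_assoc)
    also have "\<xi> \<dots> = \<xi> e * \<xi> (star S u \<cdot> f \<cdot> u) * \<xi> e"
      using u e f by (simp only: chars_mult sprod_idems star_conj_idems)
    finally show ?thesis using e by simp
  qed
  show "char_act S s \<xi> f = char_act S t \<xi> f"
    using f *[OF s] *[OF t] e by simp
qed (use s t germ_pair_act in auto)

section \<open>The universal groupoid\<close>

abbreviation (input) "\<G> \<equiv> universal_groupoid S"

lemma arr_universal: "arr \<G> = {germ_of S s \<xi> |s \<xi>. germ_pair s \<xi>}"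
  by (auto simp: universal_groupoid_def germ_pair_def)

lemma obj_universal [simp]: "obj \<G> = chars S"
  by (simp add: universal_groupoid_def)

lemma arr_universalI [intro]: "germ_pair s \<xi> \<Longrightarrow> germ_of S s \<xi> \<in> arr \<G>"
  by (auto simp: arr_universal)

lemma arr_universalE:
  assumes "g \<in> arr \<G>" obtains s \<xi> where "germ_pair s \<xi>" "g = germ_of S s \<xi>"
  using assms by (auto simp: arr_universal)

text \<open>Each \<open>THE\<close> in \<open>universal_groupoid\<close> has the intended value once
  that value is independent of the representative. Here two idempotents \<open>e\<close>,
  \<open>f\<close> of value 1 have the same germ, witnessed by \<open>fe\<close>.\<close>

lemma unit_universal:
  assumes e: "e \<in> idems S" and x: "\<xi> \<in> chars S" "\<xi> e = 1"
  shows "unit \<G> \<xi> = germ_of S e \<xi>"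
proof -
  have *: "germ_of S f \<xi> = germ_of S e \<xi>" if "f \<in> idems S" "\<xi> f = 1" for f
    by (rule germ_of_eqI[where e = "f \<cdot> e"])
      (use e x that in \<open>auto simp: germ_pair_idem chars_mult idems_left_commute[of e f e]\<close>)
  show ?thesis
    unfolding universal_groupoid_def groupoid_str.simps
    by (rule the_equality) (use e x * in blast)+
qed

lemma gdom_universal [simp]:
  assumes "germ_pair s \<xi>"
  shows "gdom \<G> (germ_of S s \<xi>) = \<xi>"
  \<comment> \<open>Regrouping conjunctions to the left isolates the first two conjuncts, which then
    fold into \<open>germ_pair\<close>.\<close>
  unfolding universal_groupoid_def groupoid_str.simps germ_pair_def[symmetric] conj_assoc[symmetric]
  by (rule the_equality) (use assms in \<open>auto simp: germ_of_eq_iff\<close>)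

lemma grng_universal [simp]:
  assumes "germ_pair s \<xi>"
  shows "grng \<G> (germ_of S s \<xi>) = char_act S s \<xi>"
  unfolding universal_groupoid_def groupoid_str.simps germ_pair_def[symmetric] conj_assoc[symmetric]
proof (rule the_equality, goal_cases)
  case 1
  then show ?case
    using assms by blast
next
  case (2 \<eta>)
  then obtain t \<zeta> where t: "germ_pair t \<zeta>" "germ_of S s \<xi> = germ_of S t \<zeta>" "\<eta> = char_act S t \<zeta>"
    by blast
  obtain e where e: "\<xi> = \<zeta>" "e \<in> idems S" "\<xi> e = 1" "s \<cdot> e = t \<cdot> e"
    using germ_of_eqE[OF assms t(1,2)] .
  show ?case
    using char_act_germ_cong[OF assms _ e(2-4)] t e(1) by simp
qed

text \<open>If \<open>se = te\<close> and \<open>\<xi> e = 1\<close>, then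
  \<open>ses\<^sup>*\<close> and \<open>tet\<^sup>*\<close> are one idempotent, of value 1 at
  \<open>char_act S s \<xi>\<close>. Multiplying it by \<open>s\<^sup>*\<close> or by
  \<open>t\<^sup>*\<close> gives the inverse of \<open>se = te\<close>, so it witnesses that the two
  inverse germs agree.\<close>

lemma ginv_universal [simp]:
  assumes s: "germ_pair s \<xi>"
  shows "ginv \<G> (germ_of S s \<xi>) = germ_of S (star S s) (char_act S s \<xi>)"
proof -
  have *: "germ_of S (star S t) (char_act S t \<xi>) = germ_of S (star S s) (char_act S s \<xi>)"
    if t: "germ_pair t \<xi>" and e: "e \<in> idems S" "\<xi> e = 1" "s \<cdot> e = t \<cdot> e" for t e
  proof -
    have S: "s \<in> carrier S" "t \<in> carrier S" "\<xi> \<in> chars S" "\<xi> (star S s \<cdot> s) = 1"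
      using s t by (auto simp: germ_pairD)
    have act: "char_act S t \<xi> = char_act S s \<xi>"
      using char_act_germ_cong[OF s t e] by simp
    have star: "star S u \<cdot> (u \<cdot> e \<cdot> star S u) = star S (u \<cdot> e)" if "u \<in> carrier S" for u
      using that e idems_left_commute[of "star S u \<cdot> u" e "star S u"]
      by (simp add: star_sprod sprod_assoc)
    \<comment> \<open>Expresses \<open>ueu\<^sup>*\<close> through \<open>ue\<close> alone, so that
      \<open>se = te\<close> carries over to it.\<close>
    have conj: "u \<cdot> e \<cdot> star S u = u \<cdot> e \<cdot> star S (u \<cdot> e)" if "u \<in> carrier S" for u
      using that e by (simp add: star_sprod sprod_assoc)
    let ?g = "s \<cdot> e \<cdot> star S s"
    have g: "?g = t \<cdot> e \<cdot> star S t"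
      using conj[OF S(1)] conj[OF S(2)] e(3) by simp
    have "star S s \<cdot> ?g = star S (t \<cdot> e)"
      using star[OF S(1)] e(3) by simp
    also have "\<dots> = star S t \<cdot> ?g"
      unfolding g by (rule star[OF S(2), symmetric])
    finally have eq: "star S s \<cdot> ?g = star S t \<cdot> ?g" .
    have "star S s \<cdot> ?g \<cdot> s = star S s \<cdot> s \<cdot> e"
      using S(1) e(1) by (simp add: sprod_assoc sprod_idem_star_sprod)
    then have one: "char_act S s \<xi> ?g = 1"
      using S(1,3,4) e(1,2) by (simp add: chars_mult)
    show ?thesis
      unfolding act
    proof (rule germ_of_eqI[where e = ?g])
      show "germ_pair (star S t) (char_act S s \<xi>)"
        using germ_pair_star[OF t] act by simp
    qed (use S(1) e(1) germ_pair_star[OF s] one eq in \<open>simp_all only: conj_idems\<close>)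
  qed
  show ?thesis
    unfolding universal_groupoid_def groupoid_str.simps germ_pair_def[symmetric] conj_assoc[symmetric]
  proof (rule the_equality, goal_cases)
    case 1
    then show ?case
      using s by blast
  next
    case (2 h)
    then obtain t \<zeta> where t: "germ_pair t \<zeta>" "germ_of S s \<xi> = germ_of S t \<zeta>"
        "h = germ_of S (star S t) (char_act S t \<zeta>)"
      by blast
    obtain e where e: "\<xi> = \<zeta>" "e \<in> idems S" "\<xi> e = 1" "s \<cdot> e = t \<cdot> e"
      using germ_of_eqE[OF s t(1,2)] .
    show ?case
      using *[OF _ e(2-4)] t e(1) by simp
  qed
qed

text \<open>Let \<open>e\<close> witness the equality of the left germs and \<open>f\<close> that of
  the right ones. The idempotent \<open>e\<close> sits between the factors, so it is first pulled
  back along \<open>t\<close> to \<open>h\<close>; then \<open>fh\<close> witnesses the equality of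
  the products.\<close>

lemma gcomp_universal [simp]:
  assumes t: "germ_pair t \<xi>" and s: "germ_pair s (char_act S t \<xi>)"
  shows "germ_of S s (char_act S t \<xi>) \<odot>\<^bsub>\<G>\<^esub> germ_of S t \<xi> = germ_of S (s \<cdot> t) \<xi>"
proof -
  have *: "germ_of S (s' \<cdot> t') \<xi> = germ_of S (s \<cdot> t) \<xi>"
    if t': "germ_pair t' \<xi>" and s': "germ_pair s' (char_act S t \<xi>)"
      and act: "char_act S t' \<xi> = char_act S t \<xi>"
      and e: "e \<in> idems S" "char_act S t \<xi> e = 1" "s \<cdot> e = s' \<cdot> e"
      and f: "f \<in> idems S" "\<xi> f = 1" "t \<cdot> f = t' \<cdot> f" for s' t' e f
  proof -
    have S: "s \<in> carrier S" "t \<in> carrier S" "\<xi> \<in> chars S" "s' \<in> carrier S" "t' \<in> carrier S"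
      using s t s' t' by (auto simp: germ_pairD)
    \<comment> \<open>The value of \<open>\<xi>\<close> at \<open>h\<close> is that of
      \<open>char_act S t \<xi>\<close> at \<open>e\<close>, namely 1, and \<open>th = et\<close>
      lets \<open>h\<close> act as \<open>e\<close> on the left of \<open>t\<close>.\<close>
    define h where "h = star S t \<cdot> e \<cdot> t"
    have h: "h \<in> idems S" "\<xi> h = 1"
      using S e by (auto simp: h_def)
    have th: "t \<cdot> h = e \<cdot> t"
      using S e by (simp add: h_def sprod_star_conj)
    have "s' \<cdot> t' \<cdot> (f \<cdot> h) = s' \<cdot> (t' \<cdot> f) \<cdot> h"
      using S f h by (simp add: sprod_assoc)
    also have "\<dots> = s' \<cdot> (t \<cdot> h \<cdot> f)"
      using S f h by (simp add: sprod_assoc idems_commute[of f h] flip: f(3))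
    also have "\<dots> = s' \<cdot> e \<cdot> t \<cdot> f"
      using S f e by (simp add: th sprod_assoc)
    also have "\<dots> = s \<cdot> (t \<cdot> h) \<cdot> f"
      using S f e by (simp add: th sprod_assoc flip: e(3))
    also have "\<dots> = s \<cdot> t \<cdot> (f \<cdot> h)"
      using S f h by (simp add: sprod_assoc idems_commute[of f h])
    finally have "s' \<cdot> t' \<cdot> (f \<cdot> h) = s \<cdot> t \<cdot> (f \<cdot> h)" .
    then show ?thesis
      using S f h s' t' s t act
      by (intro germ_of_eqI[where e = "f \<cdot> h"]) (auto simp: chars_mult germ_pair_sprod)
  qed
  show ?thesis
    unfolding universal_groupoid_def groupoid_str.simps
  proof (rule the_equality, goal_cases)
    case 1
    then show ?case
      using s t unfolding germ_pair_def by blast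
  next
    case (2 k)
    then obtain s' t' \<eta> where k: "germ_pair t' \<eta>" "germ_pair s' (char_act S t' \<eta>)"
        "germ_of S s (char_act S t \<xi>) = germ_of S s' (char_act S t' \<eta>)"
        "germ_of S t \<xi> = germ_of S t' \<eta>" "k = germ_of S (s' \<cdot> t') \<eta>"
      unfolding germ_pair_def by blast
    obtain f where f: "\<xi> = \<eta>" "f \<in> idems S" "\<xi> f = 1" "t \<cdot> f = t' \<cdot> f"
      using germ_of_eqE[OF t k(1) k(4)] .
    obtain e where e: "char_act S t \<xi> = char_act S t' \<eta>" "e \<in> idems S"
        "char_act S t \<xi> e = 1" "s \<cdot> e = s' \<cdot> e"
      using germ_of_eqE[OF s k(2) k(3)] .
    note k' = k[folded f(1)] and act = e(1)[folded f(1)]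
    show ?case
      unfolding k'(5)
      by (rule *[OF k'(1) _ act[symmetric] e(2-4) f(2-4)]) (use k'(2) in \<open>simp only: act\<close>)
  qed
qed

text \<open>The middle character is a variable here, so the rule can rewrite a product whose middle
  character is only provably equal to \<open>char_act S t \<xi>\<close>.\<close>

lemma gcomp_universal':
  assumes "germ_pair t \<xi>" "germ_pair s \<eta>" "\<eta> = char_act S t \<xi>"
  shows "germ_of S s \<eta> \<odot>\<^bsub>\<G>\<^esub> germ_of S t \<xi> = germ_of S (s \<cdot> t) \<xi>"
  using assms by simp

lemma groupoid_universal: "groupoid \<G>"
proof
  fix \<alpha> assume "\<alpha> \<in> arr \<G>"
  then obtain s \<xi> where a: "germ_pair s \<xi>" "\<alpha> = germ_of S s \<xi>"
    by (rule arr_universalE)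
  note D = germ_pairD[OF a(1)] germ_pair_act[OF a(1)] germ_pair_star[OF a(1)]
  \<comment> \<open>Representing the units at domain and range by \<open>s\<^sup>*s\<close> and
    \<open>ss\<^sup>*\<close> reduces the unit and inverse laws to identities such as
    \<open>ss\<^sup>*s = s\<close>.\<close>
  have u: "unit \<G> \<xi> = germ_of S (star S s \<cdot> s) \<xi>" "germ_pair (star S s \<cdot> s) \<xi>"
      "char_act S (star S s \<cdot> s) \<xi> = \<xi>"
    using D by (auto simp: unit_universal germ_pair_idem char_act_idem)
  have v: "unit \<G> (char_act S s \<xi>) = germ_of S (s \<cdot> star S s) (char_act S s \<xi>)"
      "germ_pair (s \<cdot> star S s) (char_act S s \<xi>)"
    using D by (auto simp: unit_universal germ_pair_idem simp del: char_act_apply)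
  show "gdom \<G> \<alpha> \<in> obj \<G>" "grng \<G> \<alpha> \<in> obj \<G>" "ginv \<G> \<alpha> \<in> arr \<G>"
      "gdom \<G> (ginv \<G> \<alpha>) = grng \<G> \<alpha>" "grng \<G> (ginv \<G> \<alpha>) = gdom \<G> \<alpha>"
    using a D by (auto simp: char_act_star_act)
  show "\<alpha> \<odot>\<^bsub>\<G>\<^esub> unit \<G> (gdom \<G> \<alpha>) = \<alpha>"
    using a u D by (simp add: gcomp_universal')
  show "unit \<G> (grng \<G> \<alpha>) \<odot>\<^bsub>\<G>\<^esub> \<alpha> = \<alpha>"
    using a v D by (simp add: gcomp_universal' sprod_assoc)
  show "ginv \<G> \<alpha> \<odot>\<^bsub>\<G>\<^esub> \<alpha> = unit \<G> (gdom \<G> \<alpha>)"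
    using a u D by (simp add: gcomp_universal')
  show "\<alpha> \<odot>\<^bsub>\<G>\<^esub> ginv \<G> \<alpha> = unit \<G> (grng \<G> \<alpha>)"
    using a v D by (simp add: gcomp_universal' char_act_star_act)
next
  fix \<xi> assume "\<xi> \<in> obj \<G>"
  then obtain e where "e \<in> idems S" "\<xi> e = 1" "\<xi> \<in> chars S"
    using chars_ex_one by auto
  then show "unit \<G> \<xi> \<in> arr \<G>" "gdom \<G> (unit \<G> \<xi>) = \<xi>" "grng \<G> (unit \<G> \<xi>) = \<xi>"
    by (auto simp: unit_universal germ_pair_idem char_act_idem)
next
  fix \<alpha> \<beta> assume "\<alpha> \<in> arr \<G>" "\<beta> \<in> arr \<G>" and c: "gdom \<G> \<alpha> = grng \<G> \<beta>"
  then obtain s \<eta> t \<xi> where "germ_pair s \<eta>" "\<alpha> = germ_of S s \<eta>" "germ_pair t \<xi>" "\<beta> = germ_of S t \<xi>"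
    by (metis arr_universalE)
  then show "\<alpha> \<odot>\<^bsub>\<G>\<^esub> \<beta> \<in> arr \<G>" "gdom \<G> (\<alpha> \<odot>\<^bsub>\<G>\<^esub> \<beta>) = gdom \<G> \<beta>" "grng \<G> (\<alpha> \<odot>\<^bsub>\<G>\<^esub> \<beta>) = grng \<G> \<alpha>"
    using c by (auto simp: germ_pair_sprod char_act_sprod germ_pairD)
next
  fix \<alpha> \<beta> \<gamma> assume "\<alpha> \<in> arr \<G>" "\<beta> \<in> arr \<G>" "\<gamma> \<in> arr \<G>"
    and c: "gdom \<G> \<alpha> = grng \<G> \<beta>" "gdom \<G> \<beta> = grng \<G> \<gamma>"
  then obtain s \<eta> t \<xi> u \<zeta> where "germ_pair s \<eta>" "\<alpha> = germ_of S s \<eta>" "germ_pair t \<xi>" "\<beta> = germ_of S t \<xi>"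
      "germ_pair u \<zeta>" "\<gamma> = germ_of S u \<zeta>"
    by (metis arr_universalE)
  then show "\<alpha> \<odot>\<^bsub>\<G>\<^esub> \<beta> \<odot>\<^bsub>\<G>\<^esub> \<gamma> = \<alpha> \<odot>\<^bsub>\<G>\<^esub> (\<beta> \<odot>\<^bsub>\<G>\<^esub> \<gamma>)"
    using c by (simp add: germ_pair_sprod gcomp_universal' char_act_sprod germ_pairD sprod_assoc)
qed

section \<open>Open sets of characters and of germs\<close>

lemma openin_char_dom:
  assumes "e \<in> idems S"
  shows "openin (char_topology S) (char_dom S e)"
proof -
  let ?P = "product_topology (\<lambda>_. discrete_topology {0, 1::nat}) (idems S)"
  \<comment> \<open>Evaluation at \<open>e\<close> is a coordinate projection to a discrete space,
    so the preimage of 1 is open.\<close>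
  have "openin ?P {\<xi> \<in> topspace ?P. \<xi> e \<in> {1}}"
    using continuous_map_product_projection[OF assms, of "\<lambda>_. discrete_topology {0, 1::nat}"]
    by (rule openin_continuous_map_preimage) simp
  moreover have "char_dom S e = {\<xi> \<in> topspace ?P. \<xi> e \<in> {1}} \<inter> chars S"
    by (auto simp: char_dom_def chars_def)
  ultimately show ?thesis
    unfolding char_topology_def openin_subtopology by blast
qed

text \<open>The generating set for \<open>s\<close> over the largest admissible \<open>U\<close>;
  unions of such sets suffice for the openness of the kernel subgroupoid.\<close>

lemma openin_universal:
  assumes s: "s \<in> carrier S"
  shows "openin (arr_top \<G>) (germ_of S s ` char_dom S (star S s \<cdot> s))"
  unfolding universal_groupoid_def groupoid_str.simps
  by (rule topology_generated_by_Basis) (use s openin_char_dom[of "star S s \<cdot> s"] in blast)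

end

section \<open>Reduction of a groupoid to an invariant set of units\<close>

lemma groupoid_reduction:
  assumes "groupoid G" and inv: "\<And>\<alpha>. \<lbrakk>\<alpha> \<in> arr G; gdom G \<alpha> \<in> F\<rbrakk> \<Longrightarrow> grng G \<alpha> \<in> F"
  shows "groupoid (reduction G F)"
proof -
  interpret groupoid G by fact
  \<comment> \<open>Invariance keeps ranges in \<open>F\<close>, and also inverses in the reduction,
    because the domain of an inverse is the range of the arrow.\<close>
  show ?thesis
    unfolding groupoid_def reduction_def
    by (simp add: dom_obj rng_obj unit_arr dom_unit rng_unit comp_arr dom_comp rng_comp comp_assoc
        comp_unit_right comp_unit_left inv_arr dom_inv rng_inv inv_comp comp_inv inv)
qed

section \<open>The kernel of a congruence\<close>

locale inverse_semigroup_congruence = inverse_semigroup +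
  fixes \<nu> :: "('a \<times> 'a) set"
  assumes congruence: "congruence S \<nu>"
begin

lemma equiv_cong: "equiv (carrier S) \<nu>"
  using congruence by (simp add: congruence_def)

lemma cong_carrier: "(s, t) \<in> \<nu> \<Longrightarrow> s \<in> carrier S \<and> t \<in> carrier S"
  using equiv_cong by (auto simp: equiv_def)

lemma cong_refl: "s \<in> carrier S \<Longrightarrow> (s, s) \<in> \<nu>"
  using equiv_cong by (auto simp: equiv_def refl_on_def)

lemma cong_sym: "(s, t) \<in> \<nu> \<Longrightarrow> (t, s) \<in> \<nu>"
  using equiv_cong by (auto simp: equiv_def sym_def)

lemma cong_trans [trans]: "\<lbrakk>(s, t) \<in> \<nu>; (t, u) \<in> \<nu>\<rbrakk> \<Longrightarrow> (s, u) \<in> \<nu>"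
  using equiv_cong by (auto simp: equiv_def trans_def)

lemma cong_sprod:
  assumes "(s, t) \<in> \<nu>" "(u, v) \<in> \<nu>"
  shows "(s \<cdot> u, t \<cdot> v) \<in> \<nu>"
proof -
  have "(s \<cdot> u, t \<cdot> u) \<in> \<nu>" "(t \<cdot> u, t \<cdot> v) \<in> \<nu>"
    using assms congruence cong_carrier[OF assms(1)] cong_carrier[OF assms(2)]
    by (auto simp: congruence_def)
  then show ?thesis by (rule cong_trans)
qed

lemma quot_map_eq_iff:
  "\<lbrakk>s \<in> carrier S; t \<in> carrier S\<rbrakk> \<Longrightarrow> quot_map \<nu> s = quot_map \<nu> t \<longleftrightarrow> (s, t) \<in> \<nu>"
  unfolding quot_map_def by (rule eq_equiv_class_iff[OF equiv_cong])

text \<open>Compatibility with products keeps the saturated product inside the class of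
  \<open>st\<close>; reflexivity, applied to \<open>s\<close> and \<open>t\<close> themselves, gives
  the other inclusion.\<close>

lemma quot_sprod:
  assumes s: "s \<in> carrier S" and t: "t \<in> carrier S"
  shows "quot_map \<nu> s \<cdot>\<^bsub>quot_semigroup S \<nu>\<^esub> quot_map \<nu> t = quot_map \<nu> (s \<cdot> t)"
proof -
  have "\<nu> `` {a \<cdot> b |a b. a \<in> \<nu> `` {s} \<and> b \<in> \<nu> `` {t}} = \<nu> `` {s \<cdot> t}"
  proof (intro equalityI subsetI)
    fix x assume "x \<in> \<nu> `` {a \<cdot> b |a b. a \<in> \<nu> `` {s} \<and> b \<in> \<nu> `` {t}}"
    then obtain a b where "(s, a) \<in> \<nu>" "(t, b) \<in> \<nu>" "(a \<cdot> b, x) \<in> \<nu>" by auto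
    then show "x \<in> \<nu> `` {s \<cdot> t}"
      using cong_trans[OF cong_sprod] by auto
  next
    fix x assume "x \<in> \<nu> `` {s \<cdot> t}"
    then show "x \<in> \<nu> `` {a \<cdot> b |a b. a \<in> \<nu> `` {s} \<and> b \<in> \<nu> `` {t}}"
      using cong_refl[OF s] cong_refl[OF t] by blast
  qed
  then show ?thesis
    by (simp add: quot_map_def quot_semigroup_def)
qed

lemma carrier_quot: "carrier (quot_semigroup S \<nu>) = quot_map \<nu> ` carrier S"
  by (auto simp: quot_semigroup_def quotient_def quot_map_def)

lemma quot_map_idem_iff:
  "s \<in> carrier S \<Longrightarrow> quot_map \<nu> s \<in> idems (quot_semigroup S \<nu>) \<longleftrightarrow> (s \<cdot> s, s) \<in> \<nu>"
  by (auto simp: idems_def[of "quot_semigroup S \<nu>"] carrier_quot quot_sprod quot_map_eq_iff)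

text \<open>Replacing the middle factor of \<open>s\<^sup>*ss\<^sup>*\<close> by the related
  \<open>ss\<close> turns \<open>s\<^sup>*\<close> into a product of the idempotents
  \<open>s\<^sup>*s\<close> and \<open>ss\<^sup>*\<close>.\<close>

lemma star_cong_idem:
  assumes s: "s \<in> carrier S" and ss: "(s \<cdot> s, s) \<in> \<nu>"
  shows "\<exists>e\<in>idems S. (star S s, e) \<in> \<nu>"
proof
  show "star S s \<cdot> s \<cdot> (s \<cdot> star S s) \<in> idems S"
    using s by auto
  have "(star S s \<cdot> s \<cdot> star S s, star S s \<cdot> (s \<cdot> s) \<cdot> star S s) \<in> \<nu>"
    using s by (intro cong_sprod cong_refl cong_sym[OF ss]) auto
  then show "(star S s, star S s \<cdot> s \<cdot> (s \<cdot> star S s)) \<in> \<nu>"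
    using s by (simp add: sprod_assoc)
qed

lemma cong_idem_sprod:
  assumes "e \<in> idems S" "(s, e) \<in> \<nu>"
  shows "(s \<cdot> s, s) \<in> \<nu>"
  using cong_trans[OF cong_sprod[OF assms(2) assms(2)]] cong_sym[OF assms(2)] assms(1) by simp

abbreviation "K \<equiv> cong_ker S \<nu>"

text \<open>Lallement's lemma: if \<open>s\<close> is idempotent modulo \<open>\<nu>\<close>, then \<open>s\<^sup>*\<close> is \<open>\<nu>\<close>-related to an idempotent
  by \<open>star_cong_idem\<close>, so the same applies to \<open>s = s\<^sup>*\<^sup>*\<close>.\<close>

lemma cong_ker_iff: "s \<in> carrier K \<longleftrightarrow> s \<in> carrier S \<and> (\<exists>e\<in>idems S. (s, e) \<in> \<nu>)"
proof -
  have "\<exists>e\<in>idems S. (s, e) \<in> \<nu>" if s: "s \<in> carrier S" "(s \<cdot> s, s) \<in> \<nu>" for s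
  proof -
    obtain e where "e \<in> idems S" "(star S s, e) \<in> \<nu>"
      using star_cong_idem[OF s] by auto
    from cong_idem_sprod[OF this] star_cong_idem[of "star S s"] s show ?thesis
      by auto
  qed
  then show ?thesis
    by (auto simp: cong_ker_def quot_map_idem_iff cong_idem_sprod)
qed

lemma cong_ker_carrier: "s \<in> carrier K \<Longrightarrow> s \<in> carrier S"
  by (simp add: cong_ker_iff)

lemma cong_kerE:
  assumes "s \<in> carrier K"
  obtains e where "e \<in> idems S" "(s, e) \<in> \<nu>" "s \<in> carrier S"
  using assms by (auto simp: cong_ker_iff)

lemma sprod_cong_ker [simp]: "sprod K = sprod S"
  by (simp add: cong_ker_def)

lemma idems_sub_cong_ker: "e \<in> idems S \<Longrightarrow> e \<in> carrier K"
  using cong_refl[of e] by (auto simp: cong_ker_iff)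

lemma idems_cong_ker [simp]: "idems K = idems S"
proof (intro equalityI subsetI)
  show "e \<in> idems S" if "e \<in> idems K" for e
    using that cong_ker_carrier unfolding idems_def by simp
  show "e \<in> idems K" if "e \<in> idems S" for e
    using that idems_sub_cong_ker[OF that] unfolding idems_def[of K] by simp
qed

lemma cong_ker_sprod: "\<lbrakk>s \<in> carrier K; t \<in> carrier K\<rbrakk> \<Longrightarrow> s \<cdot> t \<in> carrier K"
  using cong_sprod by (fastforce simp: cong_ker_iff)

lemma cong_ker_star: "s \<in> carrier K \<Longrightarrow> star S s \<in> carrier K"
  using star_cong_idem cong_idem_sprod by (fastforce simp: cong_ker_iff)

text \<open>If \<open>t\<close> is related to the idempotent \<open>e\<close>, then
  \<open>sts\<^sup>*\<close> is related to the idempotent \<open>ses\<^sup>*\<close>.\<close>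

lemma cong_ker_conj:
  assumes "t \<in> carrier K" "s \<in> carrier S"
  shows "s \<cdot> t \<cdot> star S s \<in> carrier K"
proof -
  obtain e where e: "e \<in> idems S" "(t, e) \<in> \<nu>" "t \<in> carrier S"
    using assms(1) by (rule cong_kerE)
  then have "(s \<cdot> t \<cdot> star S s, s \<cdot> e \<cdot> star S s) \<in> \<nu>"
    using assms by (intro cong_sprod cong_refl) auto
  then show ?thesis
    using e assms by (auto simp: cong_ker_iff)
qed

text \<open>Existence of inverses follows from closure under \<open>star S\<close>, and uniqueness
  is inherited from \<open>S\<close>. All results on inverse semigroups thereby become available for
  \<open>K\<close>.\<close>

lemma inverse_semigroup_cong_ker: "inverse_semigroup K"
proof
  fix s assume s: "s \<in> carrier K"
  show "\<exists>!t. t \<in> carrier K \<and> s = s \<cdot>\<^bsub>K\<^esub> t \<cdot>\<^bsub>K\<^esub> s \<and> t = t \<cdot>\<^bsub>K\<^esub> s \<cdot>\<^bsub>K\<^esub> t"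
  proof (rule ex1I)
    show "star S s \<in> carrier K \<and> s = s \<cdot>\<^bsub>K\<^esub> star S s \<cdot>\<^bsub>K\<^esub> s \<and> star S s = star S s \<cdot>\<^bsub>K\<^esub> s \<cdot>\<^bsub>K\<^esub> star S s"
      using cong_ker_star[OF s] cong_ker_carrier[OF s] by (simp add: sprod_assoc)
    show "t = star S s"
      if "t \<in> carrier K \<and> s = s \<cdot>\<^bsub>K\<^esub> t \<cdot>\<^bsub>K\<^esub> s \<and> t = t \<cdot>\<^bsub>K\<^esub> s \<cdot>\<^bsub>K\<^esub> t" for t
      using star_unique[of s t] that cong_ker_carrier[of s] cong_ker_carrier[of t] s by simp
  qed
qed (auto simp: cong_ker_sprod sprod_assoc cong_ker_carrier)

lemma star_cong_ker:
  assumes "s \<in> carrier K"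
  shows "star K s = star S s"
  using inverse_semigroup.star_exI[OF inverse_semigroup_cong_ker assms]
    star_unique[of s "star K s"] cong_ker_carrier[of s] cong_ker_carrier[of "star K s"] assms
  by simp

lemma chars_cong_ker [simp]: "chars K = chars S"
  by (simp add: chars_def)

lemma germ_pair_cong_ker:
  "inverse_semigroup.germ_pair K s \<xi> \<longleftrightarrow> s \<in> carrier K \<and> germ_pair s \<xi>"
  unfolding inverse_semigroup.germ_pair_def[OF inverse_semigroup_cong_ker] germ_pair_def
  by (auto simp: char_dom_def star_cong_ker cong_ker_carrier)

text \<open>The germ relation of \<open>K\<close> is contained in that of \<open>S\<close>, and the
  class in \<open>K\<close> contains its representative; by transitivity, saturating it yields
  exactly the class in \<open>S\<close>.\<close>

lemma germ_incl_germ_of: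
  assumes "s \<in> carrier K" "germ_pair s \<xi>"
  shows "germ_incl S (germ_of K s \<xi>) = germ_of S s \<xi>"
proof -
  have sub: "germ_rel K \<subseteq> germ_rel S"
    by (auto simp: germ_rel_def char_dom_def star_cong_ker cong_ker_carrier)
  have "((s, \<xi>), (s, \<xi>)) \<in> germ_rel K"
    using inverse_semigroup.equiv_germ_rel[OF inverse_semigroup_cong_ker] assms
    by (auto simp: equiv_def refl_on_def germ_pair_cong_ker)
  moreover have "trans (germ_rel S)"
    using equiv_germ_rel by (simp add: equiv_def)
  ultimately show ?thesis
    unfolding germ_incl_def germ_of_def using sub by (auto dest: transD)
qed

section \<open>Characters factoring through the quotient\<close>

abbreviation "F \<equiv> cong_chars S \<nu>"

lemma cong_chars_iff:
  "\<eta> \<in> F \<longleftrightarrow> \<eta> \<in> chars S \<and> (\<forall>e\<in>idems S. \<forall>f\<in>idems S. (e, f) \<in> \<nu> \<longrightarrow> \<eta> e = \<eta> f)"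
proof (intro iffI conjI ballI impI)
  fix e f assume "\<eta> \<in> F" "e \<in> idems S" "f \<in> idems S" "(e, f) \<in> \<nu>"
  then show "\<eta> e = \<eta> f"
    using quot_map_eq_iff[of e f] by (auto simp: cong_chars_def)
next
  assume \<eta>: "\<eta> \<in> chars S \<and> (\<forall>e\<in>idems S. \<forall>f\<in>idems S. (e, f) \<in> \<nu> \<longrightarrow> \<eta> e = \<eta> f)"
  let ?Q = "quot_semigroup S \<nu>"
  \<comment> \<open>The candidate on the quotient evaluates \<open>\<eta>\<close> at some idempotent
    of the class; constancy of \<open>\<eta>\<close> on related idempotents makes the choice
    irrelevant.\<close>
  define \<xi> where "\<xi> = (\<lambda>A\<in>idems ?Q. \<eta> (SOME e. e \<in> A \<inter> idems S))"
  have q: "quot_map \<nu> e \<in> idems ?Q" if "e \<in> idems S" for e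
    using that cong_refl by (simp add: quot_map_idem_iff)
  have \<xi>q: "\<xi> (quot_map \<nu> e) = \<eta> e" if e: "e \<in> idems S" for e
  proof -
    have "(SOME f. f \<in> quot_map \<nu> e \<inter> idems S) \<in> quot_map \<nu> e \<inter> idems S"
      by (rule someI[of _ e]) (use e cong_refl in \<open>auto simp: quot_map_def\<close>)
    then show ?thesis
      using \<eta> e q by (auto simp: \<xi>_def quot_map_def)
  qed
  \<comment> \<open>A class that is idempotent in the quotient is the class of a kernel element,
    hence by Lallement's lemma that of an idempotent of \<open>S\<close>.\<close>
  have lift: "\<exists>e\<in>idems S. A = quot_map \<nu> e" if A: "A \<in> idems ?Q" for A
  proof -
    obtain s where s: "s \<in> carrier S" "A = quot_map \<nu> s"
      using A by (auto simp: idems_def[of ?Q] carrier_quot)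
    then have "s \<in> carrier K"
      using A by (simp add: cong_ker_def)
    then show ?thesis
      using s quot_map_eq_iff by (metis cong_kerE idems_carrier)
  qed
  have "\<xi> A \<in> {0, 1}" if "A \<in> idems ?Q" for A
    using lift[OF that] \<xi>q \<eta> chars_01 by fastforce
  moreover have "\<xi> (A \<cdot>\<^bsub>?Q\<^esub> B) = \<xi> A * \<xi> B" if "A \<in> idems ?Q" "B \<in> idems ?Q" for A B
    using lift[OF that(1)] lift[OF that(2)] \<eta> by (auto simp: quot_sprod \<xi>q chars_mult)
  moreover have "\<exists>A\<in>idems ?Q. \<xi> A \<noteq> 0"
    using chars_ex_one[of \<eta>] \<eta> q \<xi>q by force
  ultimately have "\<xi> \<in> chars ?Q"
    by (auto simp: chars_def \<xi>_def)
  moreover have "\<eta> = restrict (\<xi> \<circ> quot_map \<nu>) (idems S)"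
    using \<eta> \<xi>q by (auto simp: fun_eq_iff chars_def PiE_def extensional_def)
  ultimately show "\<eta> \<in> F"
    using \<eta> by (auto simp: cong_chars_def)
qed (simp add: cong_chars_def)

text \<open>Conjugating related idempotents by \<open>s\<close> leaves them related.\<close>

lemma cong_chars_invariant:
  assumes "germ_pair s \<xi>" "\<xi> \<in> F"
  shows "char_act S s \<xi> \<in> F"
proof -
  have "\<xi> (star S s \<cdot> e \<cdot> s) = \<xi> (star S s \<cdot> f \<cdot> s)"
    if "e \<in> idems S" "f \<in> idems S" "(e, f) \<in> \<nu>" for e f
    using assms that germ_pairD(1)[OF assms(1)]
      cong_sprod[OF cong_sprod[OF cong_refl that(3)] cong_refl, of "star S s" s]
    by (simp add: cong_chars_iff)
  then show ?thesis
    using germ_pair_act[OF assms(1)] by (simp add: cong_chars_iff)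
qed

text \<open>Modulo \<open>\<nu>\<close> both \<open>s\<close> and \<open>s\<^sup>*\<close> are
  idempotents and so commute with \<open>e\<close>; hence \<open>s\<^sup>*es\<close> is related to
  \<open>es\<^sup>*s\<close>, where \<open>\<xi>\<close> takes the value \<open>\<xi> e\<close>
  because it is 1 at \<open>s\<^sup>*s\<close>.\<close>

lemma char_act_cong_ker:
  assumes s: "s \<in> carrier K" and p: "germ_pair s \<xi>" and F: "\<xi> \<in> F"
  shows "char_act S s \<xi> = \<xi>"
proof (rule chars_eqI)
  fix e assume e: "e \<in> idems S"
  note D = germ_pairD[OF p]
  obtain f where f: "f \<in> idems S" "(s, f) \<in> \<nu>"
    using s by (rule cong_kerE)
  obtain g where g: "g \<in> idems S" "(star S s, g) \<in> \<nu>"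
    using cong_ker_star[OF s] by (rule cong_kerE)
  have "(star S s \<cdot> e \<cdot> s, g \<cdot> e \<cdot> f) \<in> \<nu>"
    using f g e by (intro cong_sprod cong_refl) auto
  also have "g \<cdot> e \<cdot> f = e \<cdot> (g \<cdot> f)"
    using f g e by (simp add: sprod_assoc idems_left_commute[of g e f])
  also have "(e \<cdot> (g \<cdot> f), e \<cdot> (star S s \<cdot> s)) \<in> \<nu>"
    using e by (intro cong_sprod[OF cong_refl] cong_sprod cong_sym[OF f(2)] cong_sym[OF g(2)]) simp
  finally have "\<xi> (star S s \<cdot> e \<cdot> s) = \<xi> (e \<cdot> (star S s \<cdot> s))"
    using F e D unfolding cong_chars_iff by blast
  then show "char_act S s \<xi> e = \<xi> e"
    using e D by (simp add: chars_mult)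
qed (use p germ_pair_act germ_pairD in auto)

lemma groupoid_reduction_cong_chars: "groupoid (reduction \<G> F)"
  by (rule groupoid_reduction[OF groupoid_universal])
    (auto elim!: arr_universalE simp: cong_chars_invariant)

text \<open>Describes the image by representatives in \<open>S\<close>, so that normality and
  openness can be checked inside the universal groupoid of \<open>S\<close>.\<close>

lemma germ_incl_image:
  "germ_incl S ` arr (reduction (universal_groupoid K) F) =
    {germ_of S s \<xi> |s \<xi>. s \<in> carrier K \<and> germ_pair s \<xi> \<and> \<xi> \<in> F}"
proof -
  interpret K: inverse_semigroup K
    by (rule inverse_semigroup_cong_ker)
  have "arr (reduction (universal_groupoid K) F) =
      {germ_of K s \<xi> |s \<xi>. s \<in> carrier K \<and> germ_pair s \<xi> \<and> \<xi> \<in> F}"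
    by (auto simp: reduction_def K.arr_universal germ_pair_cong_ker)
      blast+
  then have "germ_incl S ` arr (reduction (universal_groupoid K) F) =
      {germ_incl S (germ_of K s \<xi>) |s \<xi>. s \<in> carrier K \<and> germ_pair s \<xi> \<and> \<xi> \<in> F}"
    by (simp only:) blast
  also have "\<dots> = {germ_of S s \<xi> |s \<xi>. s \<in> carrier K \<and> germ_pair s \<xi> \<and> \<xi> \<in> F}"
    by (intro Collect_cong ex_cong1) (metis germ_incl_germ_of)
  finally show ?thesis .
qed

end

section \<open>Normality and openness of the kernel subgroupoid\<close>

theorem proposition4p1p2:
  fixes S :: "('a, 'm) semigroup_str_scheme" and \<nu> :: "('a \<times> 'a) set"
  assumes "inverse_semigroup S"
    and "congruence S \<nu>"
  defines "G \<equiv> reduction (universal_groupoid S) (cong_chars S \<nu>)"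
    and "H \<equiv> germ_incl S ` arr (reduction (universal_groupoid (cong_ker S \<nu>)) (cong_chars S \<nu>))"
  shows "normal_subgroupoid H G \<and> openin (arr_top G) H"
proof -
  interpret inverse_semigroup_congruence S \<nu>
    using assms(1,2) by (simp add: inverse_semigroup_congruence_def inverse_semigroup_congruence_axioms_def)
  have H: "H = {germ_of S s \<xi> |s \<xi>. s \<in> carrier K \<and> germ_pair s \<xi> \<and> \<xi> \<in> F}"
    unfolding H_def by (rule germ_incl_image)
  have G [simp]: "arr G = {\<alpha> \<in> arr \<G>. gdom \<G> \<alpha> \<in> F}" "obj G = chars S \<inter> F" "unit G = unit \<G>"
      "gdom G = gdom \<G>" "grng G = grng \<G>" "gcomp G = gcomp \<G>" "ginv G = ginv \<G>"
      "arr_top G = subtopology (arr_top \<G>) {\<alpha> \<in> arr \<G>. gdom \<G> \<alpha> \<in> F}"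
    by (simp_all add: G_def reduction_def)
  interpret G: groupoid G
    unfolding G_def by (rule groupoid_reduction_cong_chars)
  \<comment> \<open>The representative comes with a character fixed by its action, which yields
    isotropy and lets products be computed over a single character.\<close>
  have HE: "\<exists>s \<xi>. s \<in> carrier K \<and> germ_pair s \<xi> \<and> \<xi> \<in> F \<and> char_act S s \<xi> = \<xi> \<and> \<alpha> = germ_of S s \<xi>"
    if "\<alpha> \<in> H" for \<alpha>
    using that char_act_cong_ker by (auto simp: H)
  have HI: "germ_of S s \<xi> \<in> H" if "s \<in> carrier K" "germ_pair s \<xi>" "\<xi> \<in> F" for s \<xi>
    using that by (auto simp: H)
  have "normal_subgroupoid H G"
  proof
    show "H \<subseteq> arr G"
      using HE by fastforce
    show "H \<subseteq> {\<gamma> \<in> arr G. gdom G \<gamma> = grng G \<gamma>}"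
      using HE by fastforce
    show "unit G ` obj G \<subseteq> H"
    proof
      fix \<alpha> assume "\<alpha> \<in> unit G ` obj G"
      then obtain \<xi> where x: "\<xi> \<in> chars S" "\<xi> \<in> F" "\<alpha> = unit \<G> \<xi>"
        by auto
      \<comment> \<open>The unit at \<open>\<xi>\<close> is the germ of an idempotent, and
        idempotents lie in the kernel.\<close>
      obtain e where e: "e \<in> idems S" "\<xi> e = 1"
        using chars_ex_one[OF x(1)] by auto
      then show "\<alpha> \<in> H"
        using HI[OF idems_sub_cong_ker[OF e(1)] germ_pair_idem[OF e(1) x(1) e(2)] x(2)]
        by (simp add: x(3) unit_universal[OF e(1) x(1) e(2)])
    qed
    show "ginv G \<alpha> \<in> H" if "\<alpha> \<in> H" for \<alpha>
      using HE[OF that] by (auto intro!: HI simp: cong_ker_star) (metis germ_pair_star)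
    show "\<alpha> \<odot>\<^bsub>G\<^esub> \<beta> \<in> H" if "\<alpha> \<in> H" "\<beta> \<in> H" "gdom G \<alpha> = grng G \<beta>" for \<alpha> \<beta>
      using HE[OF that(1)] HE[OF that(2)] that(3)
      by (auto intro!: HI simp: cong_ker_sprod germ_pair_sprod gcomp_universal')
    show "\<alpha> \<odot>\<^bsub>G\<^esub> \<gamma> \<odot>\<^bsub>G\<^esub> ginv G \<alpha> \<in> H" if a: "\<alpha> \<in> arr G" and c: "\<gamma> \<in> H" "gdom G \<alpha> = grng G \<gamma>" for \<alpha> \<gamma>
    proof -
      obtain t \<xi> where t: "t \<in> carrier K" "germ_pair t \<xi>" "\<xi> \<in> F" "char_act S t \<xi> = \<xi>" "\<gamma> = germ_of S t \<xi>"
        using HE[OF c(1)] by auto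
      \<comment> \<open>The character of \<open>\<alpha>\<close> is again \<open>\<xi>\<close>,
        since composability makes it the range of \<open>\<gamma>\<close> and \<open>t\<close> fixes
        \<open>\<xi>\<close>.\<close>
      obtain s where s: "germ_pair s \<xi>" "\<alpha> = germ_of S s \<xi>"
        using a c(2) t by (auto elim!: arr_universalE)
      let ?\<eta> = "char_act S s \<xi>"
      have st: "germ_pair (s \<cdot>\<^bsub>S\<^esub> t) \<xi>"
        using s t by (simp add: germ_pair_sprod)
      have st': "germ_pair (s \<cdot>\<^bsub>S\<^esub> t \<cdot>\<^bsub>S\<^esub> star S s) ?\<eta>"
        by (rule germ_pair_sprod[OF germ_pair_star[OF s(1)]])
          (simp add: st char_act_star_act[OF s(1)])
      have "\<alpha> \<odot>\<^bsub>G\<^esub> \<gamma> \<odot>\<^bsub>G\<^esub> ginv G \<alpha> = germ_of S (s \<cdot>\<^bsub>S\<^esub> t \<cdot>\<^bsub>S\<^esub> star S s) ?\<eta>"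
        using s t st by (simp add: gcomp_universal' germ_pair_star char_act_star_act)
      then show ?thesis
        using HI[of "s \<cdot>\<^bsub>S\<^esub> t \<cdot>\<^bsub>S\<^esub> star S s" ?\<eta>] st' cong_ker_conj[OF t(1)] cong_chars_invariant s t
        by (simp add: germ_pairD)
    qed
  qed
  moreover have "openin (arr_top G) H"
  proof -
    \<comment> \<open>The open set consists of all germs with a representative in the kernel;
      cutting it down to domains in \<open>F\<close> leaves \<open>H\<close>, which is thus open in
      the relative topology.\<close>
    let ?U = "\<Union>s\<in>carrier K. germ_of S s ` char_dom S (star S s \<cdot>\<^bsub>S\<^esub> s)"
    have "openin (arr_top \<G>) ?U"
      by (auto intro!: openin_universal simp: cong_ker_carrier)
    moreover have "H = ?U \<inter> {\<alpha> \<in> arr \<G>. gdom \<G> \<alpha> \<in> F}"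
    proof (intro equalityI subsetI)
      fix \<alpha> assume "\<alpha> \<in> H"
      then show "\<alpha> \<in> ?U \<inter> {\<alpha> \<in> arr \<G>. gdom \<G> \<alpha> \<in> F}"
        using HE[of \<alpha>] by (fastforce dest: germ_pairD(4))
    next
      fix \<alpha> assume "\<alpha> \<in> ?U \<inter> {\<alpha> \<in> arr \<G>. gdom \<G> \<alpha> \<in> F}"
      then obtain s \<xi> where s: "s \<in> carrier K" "germ_pair s \<xi>" "\<alpha> = germ_of S s \<xi>" "gdom \<G> \<alpha> \<in> F"
        by (auto simp: germ_pair_def cong_ker_carrier)
      then show "\<alpha> \<in> H"
        by (auto intro: HI)
    qed
    ultimately show ?thesis
      by (auto simp: openin_subtopology)
  qed
  ultimately show ?thesis ..
qed

end
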